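(* Let $\breve{\mathbf{M}}\in\mathbb{H}_S^{m\times n}$ be an $r$-separable quaternion matrix, that is, $\breve{\mathbf{M}}=\breve{\mathbf{W}}\mathbf{H}$ with $\breve{\mathbf{W}}=\breve{\mathbf{M}}(:,\mathcal{K})\in\mathbb{H}_S^{m\times r}$, $|\mathcal{K}|=r$, and $\mathbf{H}\in\mathbb{R}^{r\times n}_+$ ($r$ being minimal). Then $\breve{\mathbf{W}}$ is unique up to permutation and scaling: if $\breve{\mathbf{M}}=\breve{\mathbf{W}}_1\mathbf{H}_1=\breve{\mathbf{W}}_2\mathbf{H}_2$ are two such factorizations, with $\breve{\mathbf{W}}_1=\breve{\mathbf{M}}(:,\mathcal{K}_1)$, $\breve{\mathbf{W}}_2=\breve{\mathbf{M}}(:,\mathcal{K}_2)$, $|\mathcal{K}_1|=|\mathcal{K}_2|=r$ and $\mathbf{H}_1,\mathbf{H}_2\in\mathbb{R}^{r\times n}_+$, then $\breve{\mathbf{W}}_2=\breve{\mathbf{W}}_1\mathbf{P}\mathbf{D}$ for some permutation matrix $\mathbf{P}$ and some diagonal matrix $\mathbf{D}$ with positive diagonal entries. Moreover, if $\operatorname{rank}(\operatorname{Mat}(\breve{\mathbf{M}}))=r$, then $\mathbf{H}$ is also unique up to permutation and scaling, i.e. for any two such factorizations there are a permutation matrix $\mathbf{P}$ and a positive diagonal matrix $\mathbf{D}$ with $\breve{\mathbf{W}}_2=\breve{\mathbf{W}}_1\mathbf{P}\mathbf{D}$ and $\mathbf{H}_2=(\mathbf{P}\mathbf{D})^{-1}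\mathbf{H}_1$.
   Context: $\mathbb{H}$ denotes the quaternions $\breve q=q_0+\mathtt{i}q_1+\mathtt{j}q_2+\mathtt{k}q_3$ with $q_0,\dots,q_3\in\mathbb{R}$, and $\mathcal{S}_l(\breve q)=q_l$ for $l=0,1,2,3$, applied entrywise to quaternion vectors and matrices. $\mathbb{H}_S=\{\breve q\in\mathbb{H}: q_0\ge 0,\ q_1^2+q_2^2+q_3^2\le q_0^2\}$, and $\mathbb{H}_S^{m\times n}$ is the set of $m\times n$ matrices with entries in $\mathbb{H}_S$. $\mathbf{A}(:,\mathcal{J})$ is the submatrix of columns indexed by $\mathcal{J}$. For $\breve{\mathbf{Q}}\in\mathbb{H}^{m\times n}$, $\operatorname{Mat}(\breve{\mathbf{Q}})\in\mathbb{R}^{4m\times n}$ is the real matrix obtained by stacking $\mathcal{S}_0(\breve{\mathbf{Q}}),\mathcal{S}_1(\breve{\mathbf{Q}}),\mathcal{S}_2(\breve{\mathbf{Q}}),\mathcal{S}_3(\breve{\mathbf{Q}})$ vertically. A matrix $\breve{\mathbf{M}}\in\mathbb{H}_S^{m\times n}$ is called $r$-separable if there are an index set $\mathcal{K}\subseteq\{1,\dots,n\}$ with $|\mathcal{K}|=r$ and $\mathbf{H}\in\mathbb{R}^{r\times n}_+$ (entrywise nonnegative) such that $\breve{\mathbf{M}}=\breve{\mathbf{M}}(:,\mathcal{K})\mathbf{H}$, and $r$ is the minimal number for which such a factorization exists. *)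

theory Defs
  imports
    "HOL-Combinatorics.Permutations"
    "Jordan_Normal_Form.DL_Rank"
    "Jordan_Normal_Form.DL_Submatrix"
begin

datatype quat = Quat (qS0: real) (qS1: real) (qS2: real) (qS3: real)

lemma quat_eq_iff:
  "p = q \<longleftrightarrow> qS0 p = qS0 q \<and> qS1 p = qS1 q \<and> qS2 p = qS2 q \<and> qS3 p = qS3 q"
  by (cases p; cases q) simp

instantiation quat :: real_algebra_1
begin

definition zero_quat where "0 = Quat 0 0 0 0"
definition one_quat where "1 = Quat 1 0 0 0"
definition plus_quat where
  "p + q = Quat (qS0 p + qS0 q) (qS1 p + qS1 q) (qS2 p + qS2 q) (qS3 p + qS3 q)"
definition uminus_quat where
  "- q = Quat (- qS0 q) (- qS1 q) (- qS2 q) (- qS3 q)"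
definition minus_quat where
  "p - q = Quat (qS0 p - qS0 q) (qS1 p - qS1 q) (qS2 p - qS2 q) (qS3 p - qS3 q)"
definition times_quat where
  "p * q = Quat
     (qS0 p * qS0 q - qS1 p * qS1 q - qS2 p * qS2 q - qS3 p * qS3 q)
     (qS0 p * qS1 q + qS1 p * qS0 q + qS2 p * qS3 q - qS3 p * qS2 q)
     (qS0 p * qS2 q - qS1 p * qS3 q + qS2 p * qS0 q + qS3 p * qS1 q)
     (qS0 p * qS3 q + qS1 p * qS2 q - qS2 p * qS1 q + qS3 p * qS0 q)"
definition scaleR_quat where
  "c *\<^sub>R q = Quat (c * qS0 q) (c * qS1 q) (c * qS2 q) (c * qS3 q)"

instance
  by standard
    (simp_all add: quat_eq_iff zero_quat_def one_quat_def plus_quat_def uminus_quat_def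
      minus_quat_def times_quat_def scaleR_quat_def algebra_simps)

end

lemma of_real_quat: "of_real c = Quat c 0 0 0"
  by (simp add: of_real_def scaleR_quat_def one_quat_def)

definition HS :: "quat set" where
  "HS = {q. 0 \<le> qS0 q \<and> (qS1 q)\<^sup>2 + (qS2 q)\<^sup>2 + (qS3 q)\<^sup>2 \<le> (qS0 q)\<^sup>2}"

definition HS_carrier_mat :: "nat \<Rightarrow> nat \<Rightarrow> quat mat set" where
  "HS_carrier_mat m n = {M \<in> carrier_mat m n. \<forall>i<m. \<forall>j<n. M $$ (i, j) \<in> HS}"

definition nonneg_carrier_mat :: "nat \<Rightarrow> nat \<Rightarrow> real mat set" where
  "nonneg_carrier_mat m n = {A \<in> carrier_mat m n. \<forall>i<m. \<forall>j<n. 0 \<le> A $$ (i, j)}"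

text \<open>A real matrix multiplies a quaternion matrix through the embedding of the reals into
  the quaternions.\<close>

abbreviation quat_mat :: "real mat \<Rightarrow> quat mat" where
  "quat_mat \<equiv> map_mat of_real"

text \<open>Columns are numbered from 0, and the selected columns appear in increasing order of
  their indices.\<close>

definition col_submatrix :: "'a mat \<Rightarrow> nat set \<Rightarrow> 'a mat" where
  "col_submatrix A J = submatrix A UNIV J"

definition Mat :: "quat mat \<Rightarrow> real mat" where
  "Mat Q = map_mat qS0 Q @\<^sub>r map_mat qS1 Q @\<^sub>r map_mat qS2 Q @\<^sub>r map_mat qS3 Q"

definition separable_factorization :: "quat mat \<Rightarrow> nat \<Rightarrow> nat set \<Rightarrow> real mat \<Rightarrow> bool" where
  "separable_factorization M r K H \<longleftrightarrow>
     K \<subseteq> {..<dim_col M} \<and> card K = r \<and> H \<in> nonneg_carrier_mat r (dim_col M) \<and>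
     M = col_submatrix M K * quat_mat H"

definition r_separable :: "nat \<Rightarrow> quat mat \<Rightarrow> bool" where
  "r_separable r M \<longleftrightarrow>
     M \<in> HS_carrier_mat (dim_row M) (dim_col M) \<and>
     (\<exists>K H. separable_factorization M r K H) \<and>
     (\<forall>s K H. separable_factorization M s K H \<longrightarrow> r \<le> s)"

definition permutation_mat :: "nat \<Rightarrow> real mat \<Rightarrow> bool" where
  "permutation_mat r P \<longleftrightarrow>
     (\<exists>p. p permutes {..<r} \<and> P = mat r r (\<lambda>(i, j). if i = p j then 1 else 0))"

definition pos_diagonal_mat :: "nat \<Rightarrow> real mat \<Rightarrow> bool" where
  "pos_diagonal_mat r D \<longleftrightarrow> D \<in> carrier_mat r r \<and> diagonal_mat D \<and> (\<forall>i<r. 0 < D $$ (i, i))"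

definition inverse_mat_of :: "nat \<Rightarrow> 'a::semiring_1 mat \<Rightarrow> 'a mat \<Rightarrow> bool" where
  "inverse_mat_of r A B \<longleftrightarrow>
     A \<in> carrier_mat r r \<and> B \<in> carrier_mat r r \<and> inverts_mat A B \<and> inverts_mat B A"

end

theory Submission
  imports Defs
begin

text \<open>Let A be the columns of H1 indexed by K2, and B the columns of H2 indexed by K1. Then
  W2 = W1 A and W1 = W2 B, so W1 = W1 (A B) with A B entrywise nonnegative. By minimality no column
  of W1 is a nonnegative combination of the others, and nonnegative combinations in the cone HS
  cannot cancel; together these force A B = I, and symmetrically B A = I. Nonnegative matrices that
  are inverse to each other are monomial, so A = P D. If Mat M has rank r, the columns of W2 are
  linearly independent over the reals, and W2 H2 = W1 H1 = W2 B H1 yields H2 = B H1 with B the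
  inverse of P D.\<close>

section \<open>Quaternion components and the cone \<open>HS\<close>\<close>

lemma quat_simps [simp]:
  "qS0 0 = 0" "qS1 0 = 0" "qS2 0 = 0" "qS3 0 = 0"
  "qS0 (p + q) = qS0 p + qS0 q" "qS1 (p + q) = qS1 p + qS1 q"
  "qS2 (p + q) = qS2 p + qS2 q" "qS3 (p + q) = qS3 p + qS3 q"
  "qS0 (c *\<^sub>R q) = c * qS0 q" "qS1 (c *\<^sub>R q) = c * qS1 q"
  "qS2 (c *\<^sub>R q) = c * qS2 q" "qS3 (c *\<^sub>R q) = c * qS3 q"
  by (simp_all add: zero_quat_def plus_quat_def scaleR_quat_def)

lemma quat_sum_simps [simp]:
  "qS0 (sum f A) = (\<Sum>x\<in>A. qS0 (f x))" "qS1 (sum f A) = (\<Sum>x\<in>A. qS1 (f x))"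
  "qS2 (sum f A) = (\<Sum>x\<in>A. qS2 (f x))" "qS3 (sum f A) = (\<Sum>x\<in>A. qS3 (f x))"
  by (induction A rule: infinite_finite_induct) simp_all

lemma HS_qS0_eq_0:
  assumes "q \<in> HS" "qS0 q = 0"
  shows "q = 0"
proof -
  have *: "(qS1 q)\<^sup>2 + (qS2 q)\<^sup>2 + (qS3 q)\<^sup>2 \<le> 0"
    using assms by (simp add: HS_def)
  have "(qS1 q)\<^sup>2 = 0" "(qS2 q)\<^sup>2 = 0" "(qS3 q)\<^sup>2 = 0"
    using * zero_le_power2[of "qS1 q"] zero_le_power2[of "qS2 q"] zero_le_power2[of "qS3 q"]
    by linarith+
  then show ?thesis
    using assms(2) by (simp add: quat_eq_iff)
qed

text \<open>Nonnegative combinations in \<open>HS\<close> cannot cancel: the real parts of the terms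
  are nonnegative and sum to 0, so each vanishes, and an element of \<open>HS\<close> with real part
  0 is 0.\<close>

lemma HS_pointed:
  assumes "finite A" "\<And>k. k \<in> A \<Longrightarrow> 0 \<le> c k" "\<And>k. k \<in> A \<Longrightarrow> q k \<in> HS"
    and "(\<Sum>k\<in>A. c k *\<^sub>R q k) = 0" "k \<in> A"
  shows "c k = 0 \<or> q k = 0"
proof -
  have "(\<Sum>k\<in>A. c k * qS0 (q k)) = 0"
    using arg_cong[OF assms(4), of qS0] by simp
  then have "c k * qS0 (q k) = 0"
    using assms by (subst (asm) sum_nonneg_eq_0_iff) (auto simp: HS_def)
  then show ?thesis
    using HS_qS0_eq_0 assms(3,5) by auto
qed

section \<open>Real matrices acting on quaternion matrices, and the real matrix
  \<open>Mat\<close>\<close>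

lemma quat_times_of_real: "(q :: quat) * of_real c = c *\<^sub>R q"
  by (simp add: of_real_def)

lemma quat_mat_mult:
  assumes "A \<in> carrier_mat k l" "B \<in> carrier_mat l n"
  shows "quat_mat (A * B) = quat_mat A * quat_mat B"
proof -
  have "semiring_hom (of_real :: real \<Rightarrow> quat)"
    by unfold_locales auto
  then show ?thesis
    using assms by (rule semiring_hom.mat_hom_mult)
qed

lemma index_mult_quat_mat:
  assumes "Q \<in> carrier_mat m k" "R \<in> carrier_mat k n" "i < m" "j < n"
  shows "(Q * quat_mat R) $$ (i, j) = (\<Sum>a<k. R $$ (a, j) *\<^sub>R Q $$ (i, a))"
  using assms by (simp add: scalar_prod_def quat_times_of_real atLeast0LessThan)

lemma append_rows_mult:
  fixes A :: "'a :: semiring_0 mat"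
  assumes "A \<in> carrier_mat m k" "B \<in> carrier_mat l k" "R \<in> carrier_mat k n"
  shows "(A @\<^sub>r B) * R = (A * R) @\<^sub>r (B * R)"
  by (rule eq_matI) (use assms in \<open>auto simp: append_rows_def scalar_prod_def\<close>)

lemma Mat_carrier: "Q \<in> carrier_mat m n \<Longrightarrow> Mat Q \<in> carrier_mat (4 * m) n"
  unfolding Mat_def append_rows_def carrier_mat_def by simp

text \<open>Each component map is real-linear, so it commutes with right multiplication by a real
  matrix. This carries factorizations of \<open>M\<close> over to \<open>Mat M\<close>, where real
  rank arguments apply.\<close>

lemma Mat_mult:
  assumes "Q \<in> carrier_mat m k" "R \<in> carrier_mat k n"
  shows "Mat (Q * quat_mat R) = Mat Q * R"
proof -
  have *: "map_mat f (Q * quat_mat R) = map_mat f Q * R" if "f \<in> {qS0, qS1, qS2, qS3}" for f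
  proof (rule eq_matI)
    fix i j assume "i < dim_row (map_mat f Q * R)" "j < dim_col (map_mat f Q * R)"
    then have "i < m" "j < n" using assms by auto
    then show "map_mat f (Q * quat_mat R) $$ (i, j) = (map_mat f Q * R) $$ (i, j)"
      using that assms
      by (auto simp: scalar_prod_def quat_times_of_real mult.commute)
  qed (use assms in auto)
  show ?thesis
    \<comment> \<open>The stacking nests to the right, so the lower blocks have 3m, 2m and m rows in
      turn.\<close>
    unfolding Mat_def using assms
    by (simp add: * append_rows_mult[where k = k and n = n and m = m and l = "m + (m + m)"]
        append_rows_mult[where k = k and n = n and m = m and l = "m + m"]
        append_rows_mult[where k = k and n = n and m = m and l = m])
qed

section \<open>Selecting columns\<close>

lemma pick_bij_betw:
  assumes "finite K" "card K = r"
  shows "bij_betw (pick K) {..<r} K"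
proof (rule bij_betw_imageI)
  show inj: "inj_on (pick K) {..<r}"
    using assms by (intro inj_onI) (metis lessThan_iff linorder_neqE_nat less_irrefl pick_mono_le)
  show "pick K ` {..<r} = K"
    using assms by (intro card_subset_eq) (auto simp: card_image[OF inj] intro: pick_in_set_le)
qed

lemma col_submatrix_carrier:
  assumes "A \<in> carrier_mat m n" "K \<subseteq> {..<n}" "card K = r"
  shows "col_submatrix A K \<in> carrier_mat m r"
proof -
  have "{j. j < n \<and> j \<in> K} = K" using assms by auto
  then show ?thesis
    using assms by (auto simp: col_submatrix_def dim_submatrix)
qed

lemma col_submatrix_index:
  assumes "A \<in> carrier_mat m n" "K \<subseteq> {..<n}" "i < m" "j < card K"
  shows "col_submatrix A K $$ (i, j) = A $$ (i, pick K j)"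
proof -
  have "{j. j < n \<and> j \<in> K} = K" using assms by auto
  then show ?thesis
    using assms by (simp add: col_submatrix_def submatrix_index pick_UNIV)
qed

lemma pick_less:
  assumes "K \<subseteq> {..<n}" "j < card K"
  shows "pick K j < n"
  using pick_in_set_le[OF assms(2)] assms(1) by auto

lemma col_submatrix_mult:
  fixes W :: "'a :: semiring_0 mat"
  assumes "W \<in> carrier_mat m r" "H \<in> carrier_mat r n" "K \<subseteq> {..<n}"
  shows "col_submatrix (W * H) K = W * col_submatrix H K"
proof -
  note c = col_submatrix_carrier[OF _ assms(3) refl]
  have WH: "W * H \<in> carrier_mat m n" using assms by simp
  show ?thesis
  proof (rule eq_matI)
    fix i j assume "i < dim_row (W * col_submatrix H K)" "j < dim_col (W * col_submatrix H K)"
    then have ij: "i < m" "j < card K" using assms c[OF assms(2)] by auto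
    show "col_submatrix (W * H) K $$ (i, j) = (W * col_submatrix H K) $$ (i, j)"
      using ij assms c[OF assms(2)] pick_less[OF assms(3) ij(2)] WH
      by (simp add: col_submatrix_index[OF WH assms(3)] col_submatrix_index[OF assms(2,3)]
          scalar_prod_def)
  qed (use assms c[OF assms(2)] c[OF WH] in auto)
qed

lemma col_submatrix_map_mat:
  assumes "H \<in> carrier_mat r n" "K \<subseteq> {..<n}"
  shows "col_submatrix (map_mat f H) K = map_mat f (col_submatrix H K)"
proof -
  have fH: "map_mat f H \<in> carrier_mat r n" using assms by simp
  note c = col_submatrix_carrier[OF _ assms(2) refl]
  show ?thesis
    using c[OF fH] c[OF assms(1)] pick_less[OF assms(2)] assms(1)
    by (intro eq_matI) (auto simp: col_submatrix_index[OF fH assms(2)]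
        col_submatrix_index[OF assms(1,2)])
qed

lemma col_submatrix_nonneg:
  assumes "H \<in> nonneg_carrier_mat r n" "K \<subseteq> {..<n}" "card K = k"
  shows "col_submatrix H K \<in> nonneg_carrier_mat r k"
proof -
  have H: "H \<in> carrier_mat r n" using assms by (simp add: nonneg_carrier_mat_def)
  show ?thesis
    using assms col_submatrix_carrier[OF H assms(2,3)] pick_less[OF assms(2)]
    by (auto simp: nonneg_carrier_mat_def col_submatrix_index[OF H assms(2)])
qed

lemma mult_nonneg_carrier_mat:
  assumes "A \<in> nonneg_carrier_mat k l" "B \<in> nonneg_carrier_mat l n"
  shows "A * B \<in> nonneg_carrier_mat k n"
  using assms by (auto simp: nonneg_carrier_mat_def scalar_prod_def intro!: sum_nonneg)

section \<open>Separable factorizations and minimality\<close>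

lemma separable_factorizationD:
  assumes "separable_factorization M r K H" "M \<in> carrier_mat m n"
  shows "K \<subseteq> {..<n}" "card K = r" "finite K" "H \<in> nonneg_carrier_mat r n" "H \<in> carrier_mat r n"
    "col_submatrix M K \<in> carrier_mat m r" "M = col_submatrix M K * quat_mat H"
proof -
  show "K \<subseteq> {..<n}" "card K = r" "H \<in> nonneg_carrier_mat r n" "H \<in> carrier_mat r n"
     "M = col_submatrix M K * quat_mat H"
    using assms by (auto simp: separable_factorization_def nonneg_carrier_mat_def)
  then show "finite K" "col_submatrix M K \<in> carrier_mat m r"
    using assms(2) col_submatrix_carrier finite_subset by blast+
qed

text \<open>Selecting the columns \<open>L\<close> on both sides of
  \<open>M = col_submatrix M K * quat_mat H\<close> affects only the right factor.\<close>

lemma separable_factorization_change_cols: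
  assumes "M \<in> carrier_mat m n"
    and "separable_factorization M r K H" "separable_factorization M s L G"
  shows "col_submatrix M L = col_submatrix M K * quat_mat (col_submatrix H L)"
proof -
  note K = separable_factorizationD[OF assms(2,1)]
  note L = separable_factorizationD[OF assms(3,1)]
  have "col_submatrix M L = col_submatrix (col_submatrix M K * quat_mat H) L"
    using K(7) by simp
  also have "\<dots> = col_submatrix M K * quat_mat (col_submatrix H L)"
    using K L by (subst col_submatrix_mult[OF K(6)]) (auto simp: col_submatrix_map_mat)
  finally show ?thesis .
qed

text \<open>A selected column that is a nonnegative combination of the other selected ones can be
  substituted away, and the coefficients stay nonnegative. This is how minimality of
  \<open>r\<close> gets contradicted.\<close>

lemma separable_factorization_drop_col:
  assumes M: "M \<in> carrier_mat m n" and fac: "separable_factorization M r K H" and j: "j < r"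
    and c: "\<And>k. 0 \<le> c k"
    and comb: "\<And>i. i < m \<Longrightarrow> col_submatrix M K $$ (i, j) =
      (\<Sum>k\<in>{..<r} - {j}. c k *\<^sub>R col_submatrix M K $$ (i, k))"
  shows "\<exists>L G. separable_factorization M (r - 1) L G"
proof -
  note K = separable_factorizationD[OF fac M]
  define W where "W = col_submatrix M K"
  define L where "L = K - {pick K j}"
  have bK: "bij_betw (pick K) {..<r} K"
    using K by (intro pick_bij_betw)
  then have jK: "pick K j \<in> K" using j bij_betwE by blast
  have cL: "card L = r - 1" "finite L" "L \<subseteq> {..<n}"
    using jK K by (auto simp: L_def)
  have bL: "bij_betw (pick L) {..<r - 1} L"
    using cL by (intro pick_bij_betw)
  have bKj: "bij_betw (pick K) ({..<r} - {j}) L"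
    unfolding L_def using bK j by (intro bij_betw_DiffI) (auto simp: bij_betw_def)
  \<comment> \<open>Removing \<open>pick K j\<close> shifts the numbering of the later columns:
    position \<open>a\<close> in \<open>L\<close> is position \<open>\<sigma> a\<close> in
    \<open>K\<close>.\<close>
  define \<sigma> where "\<sigma> = inv_into ({..<r} - {j}) (pick K) \<circ> pick L"
  have b\<sigma>: "bij_betw \<sigma> {..<r - 1} ({..<r} - {j})"
    unfolding \<sigma>_def by (rule bij_betw_trans[OF bL bij_betw_inv_into[OF bKj]])
  have pick\<sigma>: "pick K (\<sigma> a) = pick L a" if "a < r - 1" for a
    using bij_betw_inv_into_right[OF bKj] bij_betwE[OF bL] that by (auto simp: \<sigma>_def)
  \<comment> \<open>Row \<open>j\<close> of \<open>H\<close> is distributed over the remaining rows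
    with weights \<open>c\<close>.\<close>
  define G where "G = mat (r - 1) n (\<lambda>(a, l). H $$ (\<sigma> a, l) + c (\<sigma> a) * H $$ (j, l))"
  have \<sigma>r: "\<sigma> a < r" if "a < r - 1" for a
    using bij_betwE[OF b\<sigma>] that by auto
  have GC: "G \<in> carrier_mat (r - 1) n" by (simp add: G_def)
  have GN: "G \<in> nonneg_carrier_mat (r - 1) n"
    using K(4) c j \<sigma>r by (auto simp: nonneg_carrier_mat_def G_def)
  have LC: "col_submatrix M L \<in> carrier_mat m (r - 1)"
    using col_submatrix_carrier[OF M] cL by blast
  have entry: "M $$ (i, l) = (col_submatrix M L * quat_mat G) $$ (i, l)" if il: "i < m" "l < n" for i l
  proof -
    have WL: "col_submatrix M L $$ (i, a) = W $$ (i, \<sigma> a)" if "a < r - 1" for a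
      using that il cL K \<sigma>r[OF that] pick\<sigma>[OF that]
      by (simp add: W_def col_submatrix_index[OF M])
    have "M $$ (i, l) = (\<Sum>k<r. H $$ (k, l) *\<^sub>R W $$ (i, k))"
      using K(7) index_mult_quat_mat[OF K(6) K(5) il] by (simp add: W_def)
    also have "\<dots> = H $$ (j, l) *\<^sub>R W $$ (i, j) + (\<Sum>k\<in>{..<r} - {j}. H $$ (k, l) *\<^sub>R W $$ (i, k))"
      using j by (simp add: sum.remove)
    also have "\<dots> = (\<Sum>k\<in>{..<r} - {j}. (H $$ (k, l) + c k * H $$ (j, l)) *\<^sub>R W $$ (i, k))"
      using comb[OF il(1)]
      by (simp add: W_def scaleR_sum_right scaleR_add_left sum.distrib mult.commute add.commute)
    also have "\<dots> = (\<Sum>a<r - 1. (H $$ (\<sigma> a, l) + c (\<sigma> a) * H $$ (j, l)) *\<^sub>R W $$ (i, \<sigma> a))"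
      by (rule sum.reindex_bij_betw[OF b\<sigma>, symmetric])
    also have "\<dots> = (col_submatrix M L * quat_mat G) $$ (i, l)"
      using il unfolding index_mult_quat_mat[OF LC GC il]
      by (intro sum.cong) (simp_all add: WL G_def)
    finally show ?thesis .
  qed
  have "M = col_submatrix M L * quat_mat G"
    by (rule eq_matI) (use M LC GC entry in auto)
  then have "separable_factorization M (r - 1) L G"
    using cL GN M by (simp add: separable_factorization_def)
  then show ?thesis by blast
qed

text \<open>Compare column \<open>j\<close> of both sides of \<open>WC\<close>. If
  \<open>C $$ (j, j) < 1\<close>, solving for that column writes it as a nonnegative combination of
  the others, against minimality. Otherwise moving it to the right gives a vanishing nonnegative
  combination of columns; these are nonzero with entries in \<open>HS\<close>, so every coefficient
  is 0.\<close>

lemma minimal_separable_factorization_unique_coeffs: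
  assumes M: "M \<in> HS_carrier_mat m n" and sep: "r_separable r M"
    and fac: "separable_factorization M r K H"
    and C: "C \<in> nonneg_carrier_mat r r"
    and WC: "col_submatrix M K = col_submatrix M K * quat_mat C"
  shows "C = 1\<^sub>m r"
proof -
  have Mc: "M \<in> carrier_mat m n" using M by (simp add: HS_carrier_mat_def)
  note K = separable_factorizationD[OF fac Mc]
  define W where "W = col_submatrix M K"
  have Cc: "C \<in> carrier_mat r r" and Cn: "\<And>i j. i < r \<Longrightarrow> j < r \<Longrightarrow> 0 \<le> C $$ (i, j)"
    using C by (auto simp: nonneg_carrier_mat_def)
  have WHS: "W $$ (i, k) \<in> HS" if "i < m" "k < r" for i k
    using that K M pick_less[OF K(1)]
    by (auto simp: W_def col_submatrix_index[OF Mc] HS_carrier_mat_def)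
  have indep: False if j: "j < r" and c: "\<And>k. 0 \<le> c k"
    and comb: "\<And>i. i < m \<Longrightarrow> W $$ (i, j) = (\<Sum>k\<in>{..<r} - {j}. c k *\<^sub>R W $$ (i, k))" for j c
  proof -
    obtain L G where "separable_factorization M (r - 1) L G"
      using separable_factorization_drop_col[OF Mc fac j, of c] c comb by (auto simp: W_def)
    then show False
      using sep j by (fastforce simp: r_separable_def)
  qed
  have eq: "W $$ (i, j) = C $$ (j, j) *\<^sub>R W $$ (i, j) +
      (\<Sum>k\<in>{..<r} - {j}. C $$ (k, j) *\<^sub>R W $$ (i, k))" if "i < m" "j < r" for i j
  proof -
    have "W $$ (i, j) = (\<Sum>k<r. C $$ (k, j) *\<^sub>R W $$ (i, k))"
      using WC index_mult_quat_mat[OF K(6) Cc that] by (simp add: W_def)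
    then show ?thesis
      using that(2) by (simp add: sum.remove)
  qed
  show ?thesis
  proof (rule eq_matI)
    fix k j assume "k < dim_row (1\<^sub>m r :: real mat)" "j < dim_col (1\<^sub>m r :: real mat)"
    then have k: "k < r" and j: "j < r" by auto
    have d: "1 \<le> C $$ (j, j)"
    proof (rule ccontr)
      assume d: "\<not> 1 \<le> C $$ (j, j)"
      \<comment> \<open>These weights come from solving the column equation for column
        \<open>j\<close>. The value 0 beyond \<open>r\<close> makes \<open>c\<close> nonnegative
        everywhere, as \<open>indep\<close> demands.\<close>
      define c where "c a = (if a < r then C $$ (a, j) / (1 - C $$ (j, j)) else 0)" for a
      show False
      proof (rule indep[OF j, of c])
        show "0 \<le> c a" for a using d Cn j by (simp add: c_def)
        fix i assume i: "i < m"
        have "(1 - C $$ (j, j)) *\<^sub>R W $$ (i, j) =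
            (\<Sum>k\<in>{..<r} - {j}. C $$ (k, j) *\<^sub>R W $$ (i, k))"
          using eq[OF i j] by (simp add: scaleR_diff_left algebra_simps)
        then have "inverse (1 - C $$ (j, j)) *\<^sub>R (1 - C $$ (j, j)) *\<^sub>R W $$ (i, j) =
            inverse (1 - C $$ (j, j)) *\<^sub>R (\<Sum>k\<in>{..<r} - {j}. C $$ (k, j) *\<^sub>R W $$ (i, k))"
          by simp
        then show "W $$ (i, j) = (\<Sum>k\<in>{..<r} - {j}. c k *\<^sub>R W $$ (i, k))"
          using d by (simp add: c_def scaleR_sum_right divide_inverse mult.commute)
      qed
    qed
    \<comment> \<open>This is column \<open>j\<close> of \<open>C - 1\<^sub>m r\<close>, nonnegative
      on \<open>{..<r}\<close> because of \<open>d\<close>.\<close>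
    define e where "e a = (if a = j then C $$ (j, j) - 1 else C $$ (a, j))" for a
    have e0: "(\<Sum>k<r. e k *\<^sub>R W $$ (i, k)) = 0" if i: "i < m" for i
    proof -
      have "(\<Sum>k<r. e k *\<^sub>R W $$ (i, k)) = (C $$ (j, j) - 1) *\<^sub>R W $$ (i, j) +
          (\<Sum>k\<in>{..<r} - {j}. C $$ (k, j) *\<^sub>R W $$ (i, k))"
        using j by (simp add: sum.remove e_def)
      then show ?thesis
        using eq[OF i j] by (simp add: scaleR_diff_left algebra_simps)
    qed
    \<comment> \<open>A zero column would be the combination of the others with all weights 0, which
      \<open>indep\<close> excludes.\<close>
    obtain i where i: "i < m" "W $$ (i, k) \<noteq> 0"
      using indep[OF k, of "\<lambda>_. 0"] by auto
    have "e k = 0"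
      using HS_pointed[OF _ _ _ e0[OF i(1)], of k] i k j d Cn WHS by (auto simp: e_def)
    then show "C $$ (k, j) = 1\<^sub>m r $$ (k, j)"
      using k j by (auto simp: e_def split: if_splits)
  qed (use Cc in auto)
qed

section \<open>Nonnegative matrices with nonnegative inverse\<close>

text \<open>The diagonal of \<open>B * A\<close> yields for each \<open>k\<close> a row
  \<open>q k\<close> with \<open>B $$ (k, q k)\<close> and \<open>A $$ (q k, k)\<close> nonzero. The
  off-diagonal zeros of \<open>A * B\<close> then kill all other entries in column \<open>k\<close>
  of \<open>A\<close>, so \<open>q\<close> gives the permutation and the surviving entries give the
  scaling.\<close>

lemma nonneg_inverse_imp_monomial:
  assumes A: "A \<in> nonneg_carrier_mat r r" and B: "B \<in> nonneg_carrier_mat r r"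
    and AB: "A * B = 1\<^sub>m r" and BA: "B * A = 1\<^sub>m r"
  shows "\<exists>P D. permutation_mat r P \<and> pos_diagonal_mat r D \<and> A = P * D"
proof -
  have c: "A \<in> carrier_mat r r" "B \<in> carrier_mat r r"
    and nA: "\<And>i j. i < r \<Longrightarrow> j < r \<Longrightarrow> 0 \<le> A $$ (i, j)"
    and nB: "\<And>i j. i < r \<Longrightarrow> j < r \<Longrightarrow> 0 \<le> B $$ (i, j)"
    using A B by (auto simp: nonneg_carrier_mat_def)
  \<comment> \<open>An off-diagonal entry of \<open>X * Y\<close> is a vanishing sum of nonnegative
    terms. Both \<open>A * B\<close> and \<open>B * A\<close> are needed below, hence the general
    \<open>X\<close> and \<open>Y\<close>.\<close>
  have zero: "X $$ (i, k) * Y $$ (k, j) = 0"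
    if "X \<in> nonneg_carrier_mat r r" "Y \<in> nonneg_carrier_mat r r" "X * Y = 1\<^sub>m r"
      "i < r" "j < r" "k < r" "i \<noteq> j" for X Y :: "real mat" and i j k
  proof -
    have "(X * Y) $$ (i, j) = (\<Sum>k<r. X $$ (i, k) * Y $$ (k, j))"
      using that(1,2,4,5) by (auto simp: nonneg_carrier_mat_def scalar_prod_def atLeast0LessThan)
    then have "(\<Sum>k<r. X $$ (i, k) * Y $$ (k, j)) = 0"
      using that(3,4,5,7) by simp
    then show ?thesis
      using that by (subst (asm) sum_nonneg_eq_0_iff) (auto simp: nonneg_carrier_mat_def)
  qed
  have "\<exists>l<r. B $$ (k, l) * A $$ (l, k) \<noteq> 0" if k: "k < r" for k
  proof (rule ccontr)
    assume "\<not> ?thesis"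
    then have "(\<Sum>l<r. B $$ (k, l) * A $$ (l, k)) = 0"
      by (intro sum.neutral) auto
    moreover have "(B * A) $$ (k, k) = (\<Sum>l<r. B $$ (k, l) * A $$ (l, k))"
      using c k by (simp add: scalar_prod_def atLeast0LessThan)
    ultimately show False using BA k by simp
  qed
  then obtain q where q: "\<And>k. k < r \<Longrightarrow> q k < r"
    "\<And>k. k < r \<Longrightarrow> B $$ (k, q k) \<noteq> 0" "\<And>k. k < r \<Longrightarrow> A $$ (q k, k) \<noteq> 0"
    by (metis mult_eq_0_iff)
  have off: "A $$ (i, k) = 0" if "i < r" "k < r" "i \<noteq> q k" for i k
    using zero[OF A B AB that(1) q(1)[OF that(2)] that(2,3)] q(2)[OF that(2)] by simp
  \<comment> \<open>Outside \<open>{..<r}\<close> a map that \<open>permutes\<close> this set must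
    be the identity.\<close>
  define p where "p k = (if k < r then q k else k)" for k
  have inj: "inj_on p {..<r}"
  proof (rule inj_onI, rule ccontr)
    fix k l assume kl: "k \<in> {..<r}" "l \<in> {..<r}" "p k = p l" "k \<noteq> l"
    \<comment> \<open>If \<open>q k = q l\<close>, this is a term of the off-diagonal entry
      \<open>(k, l)\<close> of \<open>B * A\<close>, yet neither factor is 0.\<close>
    then have "B $$ (k, q k) * A $$ (q k, l) = 0"
      using zero[OF B A BA, of k l "q k"] q by auto
    then show False using kl q(2)[of k] q(3)[of l] by (auto simp: p_def)
  qed
  have "p permutes {..<r}"
  proof (rule bij_imp_permutes)
    have "p ` {..<r} \<subseteq> {..<r}" using q by (auto simp: p_def)
    then show "bij_betw p {..<r} {..<r}"
      using inj by (simp add: bij_betw_def endo_inj_surj)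
  qed (simp add: p_def)
  define P :: "real mat" where "P = mat r r (\<lambda>(i, j). if i = p j then 1 else 0)"
  define D where "D = mat r r (\<lambda>(i, j). if i = j then A $$ (p j, j) else 0)"
  have "A = P * D"
  proof (rule eq_matI)
    fix i j assume "i < dim_row (P * D)" "j < dim_col (P * D)"
    then have ij: "i < r" "j < r" by (auto simp: P_def D_def)
    have "(P * D) $$ (i, j) =
        (\<Sum>k<r. (if i = p k then 1 else 0) * (if k = j then A $$ (p j, j) else 0))"
      using ij by (simp add: P_def D_def scalar_prod_def atLeast0LessThan)
    also have "\<dots> = (\<Sum>k<r. if k = j then (if i = p j then A $$ (p j, j) else 0) else 0)"
      by (intro sum.cong) auto
    also have "\<dots> = A $$ (i, j)"
      using ij off by (auto simp: p_def)
    finally show "A $$ (i, j) = (P * D) $$ (i, j)" by simp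
  qed (use c in \<open>auto simp: P_def D_def\<close>)
  moreover have "permutation_mat r P"
    using \<open>p permutes {..<r}\<close> by (auto simp: permutation_mat_def P_def)
  moreover have "pos_diagonal_mat r D"
    using nA q by (force simp: pos_diagonal_mat_def D_def diagonal_mat_def p_def less_le)
  ultimately show ?thesis by blast
qed

section \<open>Rank and cancellation of a factor of full column rank\<close>

text \<open>Each column of \<open>A * B\<close> is \<open>A\<close> applied to a column of
  \<open>B\<close>, so the column space of the product lies in that of \<open>A\<close>.\<close>

lemma (in vec_space) rank_mult_le:
  assumes A: "A \<in> carrier_mat n k" and B: "B \<in> carrier_mat k l"
  shows "rank (A * B) \<le> rank A"
proof -
  have AB: "A * B \<in> carrier_mat n l" using A B by simp
  have cA: "set (cols A) \<subseteq> carrier_vec n" and cAB: "set (cols (A * B)) \<subseteq> carrier_vec n"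
    using A AB cols_dim by blast+
  have "set (cols (A * B)) \<subseteq> span (set (cols A))"
  proof
    fix v assume "v \<in> set (cols (A * B))"
    then obtain j where j: "j < l" "v = col (A * B) j"
      using AB by (auto simp: cols_def)
    then have "v = A *\<^sub>v col B j" using col_mult2[OF A B j(1)] by simp
    then show "v \<in> span (set (cols A))"
      using A B j col_space_eq[OF A] by (auto simp: col_space_def)
  qed
  then have sub: "span (set (cols (A * B))) \<subseteq> span (set (cols A))"
    using cA span_is_submodule span_is_subset by blast
  have sA: "VectorSpace.subspace class_ring (span (set (cols A))) V"
    and sAB: "VectorSpace.subspace class_ring (span (set (cols (A * B)))) V"
    using cA cAB span_is_subspace by auto
  show ?thesis
    unfolding rank_def
    using vectorspace.subspace_dim[OF subspace_is_vs[OF sA] nested_subspaces[OF sA sAB sub]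
        fin_dim_span_cols[OF A]] fin_dim_span_cols[OF AB] by simp
qed

text \<open>Linear independence concerns the set of columns, so repeated columns must be excluded
  first: the rank \<open>k\<close> is the size of a maximal independent subset, hence there are at
  least \<open>k\<close> different columns. A nonzero \<open>v\<close> would then be a linear
  dependence.\<close>

lemma (in vec_space) full_rank_mult_vec_eq_0:
  assumes A: "A \<in> carrier_mat n k" and "rank A = k"
    and v: "v \<in> carrier_vec k" "A *\<^sub>v v = 0\<^sub>v n"
  shows "v = 0\<^sub>v k"
proof -
  obtain S where S: "maximal S (\<lambda>T. T \<subseteq> set (cols A) \<and> lin_indpt T)"
    using maximal_exists[of "\<lambda>T. T \<subseteq> set (cols A) \<and> lin_indpt T" "card (set (cols A))" "{}"]
    by (meson List.finite_set card_mono empty_iff empty_subsetI finite_lin_indpt2 rev_finite_subset)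
  then have "card S \<le> card (set (cols A))" by (simp add: card_mono maximal_def)
  then have "length (cols A) \<le> card (set (cols A))"
    using assms(1,2) rank_card_indpt[OF A S] by simp
  then have "distinct (cols A)"
    using card_length[of "cols A"] by (simp add: card_distinct)
  then show ?thesis
    using lin_depI[OF A v(1) _ v(2)] full_rank_lin_indpt[OF A assms(2)] by blast
qed

lemma full_rank_mult_cancel:
  fixes A :: "'a :: field mat"
  assumes A: "A \<in> carrier_mat n k" and rank: "vec_space.rank n A = k"
    and X: "X \<in> carrier_mat k l" and Y: "Y \<in> carrier_mat k l" and eq: "A * X = A * Y"
  shows "X = Y"
proof -
  have "col X j - col Y j = 0\<^sub>v k" if "j < l" for j
  proof (rule vec_space.full_rank_mult_vec_eq_0[OF A rank])
    have "A *\<^sub>v col X j = A *\<^sub>v col Y j"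
      using col_mult2[OF A X that] col_mult2[OF A Y that] eq by simp
    then show "A *\<^sub>v (col X j - col Y j) = 0\<^sub>v n"
      using A X Y that by (simp add: mult_minus_distrib_mat_vec)
  qed (use X Y in \<open>auto intro!: carrier_vecI\<close>)
  then have "(col X j - col Y j) $ i = 0" if "i < k" "j < l" for i j
    using that by simp
  then show ?thesis
    using X Y by (intro eq_matI) auto
qed

section \<open>Comparing two minimal factorizations\<close>

text \<open>The rank of \<open>Mat (col_submatrix M K)\<close> is at least that of the product
  \<open>Mat M\<close>, and at most its number of columns; both bounds are \<open>r\<close>.\<close>

lemma separable_factorization_rank:
  assumes M: "M \<in> carrier_mat m n" and fac: "separable_factorization M r K H"
    and rank: "vec_space.rank (4 * m) (Mat M) = r"
  shows "vec_space.rank (4 * m) (Mat (col_submatrix M K)) = r"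
proof -
  note K = separable_factorizationD[OF fac M]
  note W = Mat_carrier[OF K(6)]
  have "Mat M = Mat (col_submatrix M K) * H"
    using Mat_mult[OF K(6,5)] K(7) by simp
  then have "r \<le> vec_space.rank (4 * m) (Mat (col_submatrix M K))"
    using vec_space.rank_mult_le[OF W K(5)] rank by simp
  then show ?thesis
    using vec_space.rank_le_nc[OF W] by simp
qed

lemma minimal_separable_factorizations_related:
  assumes M: "M \<in> HS_carrier_mat m n" and sep: "r_separable r M"
    and f1: "separable_factorization M r K\<^sub>1 H\<^sub>1" and f2: "separable_factorization M r K\<^sub>2 H\<^sub>2"
  shows "\<exists>P D. permutation_mat r P \<and> pos_diagonal_mat r D \<and>
    col_submatrix M K\<^sub>2 = col_submatrix M K\<^sub>1 * quat_mat P * quat_mat D \<and>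
    inverse_mat_of r (P * D) (col_submatrix H\<^sub>2 K\<^sub>1)"
proof -
  have Mc: "M \<in> carrier_mat m n" using M by (simp add: HS_carrier_mat_def)
  have coeffs: "col_submatrix G L \<in> nonneg_carrier_mat r r"
      "col_submatrix G L \<in> carrier_mat r r"
    if "separable_factorization M r K G" "separable_factorization M r L F" for K L F G
    using col_submatrix_nonneg separable_factorizationD[OF that(1) Mc]
      separable_factorizationD[OF that(2) Mc] by (auto simp: nonneg_carrier_mat_def)
  \<comment> \<open>Passing from the columns \<open>K\<close> to \<open>L\<close> and back expresses
    the columns \<open>K\<close> through themselves with nonnegative coefficients. By symmetry in
    \<open>K\<close> and \<open>L\<close> this serves for both orders of the product.\<close>
  have inv: "col_submatrix G L * col_submatrix F K = 1\<^sub>m r"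
    if G: "separable_factorization M r K G" and F: "separable_factorization M r L F" for K L F G
  proof (rule minimal_separable_factorization_unique_coeffs[OF M sep G])
    note c = coeffs[OF G F] coeffs[OF F G]
    show "col_submatrix G L * col_submatrix F K \<in> nonneg_carrier_mat r r"
      using c by (simp add: mult_nonneg_carrier_mat)
    have "col_submatrix M K =
        (col_submatrix M K * quat_mat (col_submatrix G L)) * quat_mat (col_submatrix F K)"
      using separable_factorization_change_cols[OF Mc G F]
        separable_factorization_change_cols[OF Mc F G] by simp
    also have "\<dots> = col_submatrix M K * quat_mat (col_submatrix G L * col_submatrix F K)"
      using c separable_factorizationD(6)[OF G Mc]
      by (simp add: quat_mat_mult[OF c(2,4)] assoc_mult_mat[of _ m r _ r _ r])
    finally show "col_submatrix M K = \<dots>" .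
  qed
  note c = coeffs[OF f1 f2] coeffs[OF f2 f1]
  obtain P D where PD: "permutation_mat r P" "pos_diagonal_mat r D" "col_submatrix H\<^sub>1 K\<^sub>2 = P * D"
    using nonneg_inverse_imp_monomial[OF c(1,3) inv[OF f1 f2] inv[OF f2 f1]] by blast
  have PDc: "P \<in> carrier_mat r r" "D \<in> carrier_mat r r"
    using PD by (auto simp: permutation_mat_def pos_diagonal_mat_def)
  have "col_submatrix M K\<^sub>2 = col_submatrix M K\<^sub>1 * quat_mat P * quat_mat D"
    using separable_factorization_change_cols[OF Mc f1 f2] PD(3) PDc
      separable_factorizationD(6)[OF f1 Mc]
    by (simp add: quat_mat_mult[OF PDc] assoc_mult_mat[of _ m r _ r _ r])
  moreover have "inverse_mat_of r (P * D) (col_submatrix H\<^sub>2 K\<^sub>1)"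
    using c inv[OF f1 f2] inv[OF f2 f1] PDc by (simp add: PD(3) inverse_mat_of_def inverts_mat_def)
  ultimately show ?thesis using PD by blast
qed

text \<open>Both sides give \<open>Mat M\<close> when multiplied on the left by
  \<open>Mat (col_submatrix M K\<^sub>2)\<close>, whose full column rank allows
  cancellation.\<close>

lemma separable_factorization_full_rank_coeffs:
  assumes M: "M \<in> carrier_mat m n"
    and f1: "separable_factorization M r K\<^sub>1 H\<^sub>1" and f2: "separable_factorization M r K\<^sub>2 H\<^sub>2"
    and rank: "vec_space.rank (4 * m) (Mat M) = r"
  shows "H\<^sub>2 = col_submatrix H\<^sub>2 K\<^sub>1 * H\<^sub>1"
proof (rule full_rank_mult_cancel)
  note F1 = separable_factorizationD[OF f1 M] and F2 = separable_factorizationD[OF f2 M]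
  have B: "col_submatrix H\<^sub>2 K\<^sub>1 \<in> carrier_mat r r"
    using col_submatrix_carrier[OF F2(5) F1(1,2)] .
  let ?W = "Mat (col_submatrix M K\<^sub>2)"
  show W: "?W \<in> carrier_mat (4 * m) r" by (rule Mat_carrier[OF F2(6)])
  show "vec_space.rank (4 * m) ?W = r"
    by (rule separable_factorization_rank[OF M f2 rank])
  show "H\<^sub>2 \<in> carrier_mat r n" "col_submatrix H\<^sub>2 K\<^sub>1 * H\<^sub>1 \<in> carrier_mat r n"
    using F1(5) F2(5) B by auto
  have "?W * H\<^sub>2 = Mat M"
    using Mat_mult[OF F2(6,5)] F2(7) by simp
  also have "\<dots> = Mat (col_submatrix M K\<^sub>1) * H\<^sub>1"
    using Mat_mult[OF F1(6,5)] F1(7) by simp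
  also have "\<dots> = ?W * col_submatrix H\<^sub>2 K\<^sub>1 * H\<^sub>1"
    using separable_factorization_change_cols[OF M f2 f1] Mat_mult[OF F2(6) B] by simp
  also have "\<dots> = ?W * (col_submatrix H\<^sub>2 K\<^sub>1 * H\<^sub>1)"
    by (rule assoc_mult_mat[OF W B F1(5)])
  finally show "?W * H\<^sub>2 = ?W * (col_submatrix H\<^sub>2 K\<^sub>1 * H\<^sub>1)" .
qed

theorem mainTheorem2:
  fixes M :: "quat mat" and m n r :: nat
  assumes "M \<in> HS_carrier_mat m n"
    and "r_separable r M"
  shows "(\<forall>K\<^sub>1 K\<^sub>2 H\<^sub>1 H\<^sub>2.
      separable_factorization M r K\<^sub>1 H\<^sub>1 \<and> separable_factorization M r K\<^sub>2 H\<^sub>2 \<longrightarrow>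
      (\<exists>P D. permutation_mat r P \<and> pos_diagonal_mat r D \<and>
        col_submatrix M K\<^sub>2 = col_submatrix M K\<^sub>1 * quat_mat P * quat_mat D)) \<and>
    (vec_space.rank (4 * m) (Mat M) = r \<longrightarrow>
      (\<forall>K\<^sub>1 K\<^sub>2 H\<^sub>1 H\<^sub>2.
      separable_factorization M r K\<^sub>1 H\<^sub>1 \<and> separable_factorization M r K\<^sub>2 H\<^sub>2 \<longrightarrow>
      (\<exists>P D X. permutation_mat r P \<and> pos_diagonal_mat r D \<and>
        col_submatrix M K\<^sub>2 = col_submatrix M K\<^sub>1 * quat_mat P * quat_mat D \<and>
        inverse_mat_of r (P * D) X \<and> H\<^sub>2 = X * H\<^sub>1)))"
proof (intro conjI impI allI; elim conjE)
  fix K\<^sub>1 K\<^sub>2 H\<^sub>1 H\<^sub>2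
  assume f: "separable_factorization M r K\<^sub>1 H\<^sub>1" "separable_factorization M r K\<^sub>2 H\<^sub>2"
  show "\<exists>P D. permutation_mat r P \<and> pos_diagonal_mat r D \<and>
      col_submatrix M K\<^sub>2 = col_submatrix M K\<^sub>1 * quat_mat P * quat_mat D"
    using minimal_separable_factorizations_related[OF assms f] by blast
next
  fix K\<^sub>1 K\<^sub>2 H\<^sub>1 H\<^sub>2
  assume rank: "vec_space.rank (4 * m) (Mat M) = r"
    and f: "separable_factorization M r K\<^sub>1 H\<^sub>1" "separable_factorization M r K\<^sub>2 H\<^sub>2"
  have "M \<in> carrier_mat m n" using assms(1) by (simp add: HS_carrier_mat_def)
  then have "H\<^sub>2 = col_submatrix H\<^sub>2 K\<^sub>1 * H\<^sub>1"
    using f rank by (rule separable_factorization_full_rank_coeffs)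
  \<comment> \<open>The witness for \<open>X\<close> is
    \<open>col_submatrix H\<^sub>2 K\<^sub>1\<close>, which is both the inverse of
    \<open>P * D\<close> and the matrix taking \<open>H\<^sub>1\<close> to
    \<open>H\<^sub>2\<close>.\<close>
  then show "\<exists>P D X. permutation_mat r P \<and> pos_diagonal_mat r D \<and>
      col_submatrix M K\<^sub>2 = col_submatrix M K\<^sub>1 * quat_mat P * quat_mat D \<and>
      inverse_mat_of r (P * D) X \<and> H\<^sub>2 = X * H\<^sub>1"
    using minimal_separable_factorizations_related[OF assms f] by blast
qed

end
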